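(* Given the offline ride-hitching problem with a set $\mathbb{V}=\{V_1,\dots,V_n\}$ of $n$ rides all known in advance, the algorithm \textsc{OptimalHitching} runs in $O(n^2)$ time and outputs the sequence of rides taken by an optimal offline solution, i.e. a feasible sequence $U$ of rides from $\mathbb{V}$ minimizing the UAV's arrival time $\xi(U)$ at the destination over all feasible sequences (including the empty one).
   Context: Setting. A UAV travels on the segment $[0,a]$ from the origin $O=0$ (at time $0$) to the destination $A=a$. It flies at speed $v_0>0$ (or stops), charges at all times at rate $\alpha>0$ per unit time, and while flying consumes power at rate $\beta>\alpha$ per unit time; its power must never be negative, and there is no upper limit on stored power. Its initial power $P_0$ satisfies $0\le P_0<\frac{(\beta-\alpha)a}{v_0}$. A truck ride is $V_i=(r_i,t_i,o_i,d_i,v_i)$: it is released (announced) at time $r_i$, departs at time $t_i\ge r_i$ from location $o_i$, and moves with constant velocity $v_i$ to $d_i$, where $0\le o_i<d_i\le a$. A UAV taking a ride boards it at $(o_i,t_i)$, leaves it at $d_i$ at time $t_i+\frac{d_i-o_i}{v_i}$, and charges without consuming power while on it. In the offline problem all rides are known at time $0$. Power transfer function: $\mathrm{PTF}(P,V_i,V_j)=P+(t_j-t_i)\alpha-\frac{|o_j-d_i|\beta}{v_0}$. Feasible sequences. A sequence $U=(V_1,\dots,V_{|U|})$ of rides (relabelled in the order taken) is feasible if $t_1\ge \frac{o_1}{v_0}$, $P_1:=P_0+t_1\alpha-\frac{o_1}{v_0}\beta\ge 0$, and for $1\le i<|U|$: $t_{i+1}\ge t_i+\frac{d_i-o_i}{v_i}+\frac{|o_{i+1}-d_i|}{v_0}$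 and $P_{i+1}:=\mathrm{PTF}(P_i,V_i,V_{i+1})\ge 0$. Its arrival time is $$\xi(U)=\max\Big\{\Big(o_1+\sum_{i=1}^{|U|-1}|o_{i+1}-d_i|+a-d_{|U|}\Big)\frac{\beta}{\alpha v_0}-\frac{P_0}{\alpha},\ t_{|U|}+\frac{d_{|U|}-o_{|U|}}{v_{|U|}}+\frac{a-d_{|U|}}{v_0}\Big\},$$ and $\xi(\varnothing)=\frac{\beta}{\alpha}\frac{a}{v_0}-\frac{P_0}{\alpha}$. Algorithm \textsc{OptimalHitching}. (1) Sort the rides by increasing start location as $V_1,\dots,V_n$. Create virtual nodes $V_0=(0,0,0,0,0)$ (representing $O$; its travel time $\frac{d_0-o_0}{v_0}$ is taken to be $0$) and $V_{n+1}$ (representing $A$). (2) Build a graph $G=(N,E,w)$ with node and edge weights. Start with $N=\{V_0\}$, $w(V_0)=P_0$, $E=\varnothing$. For $i=1,\dots,n$, let $\Phi(V_i)$ be the set of $V_j\in N$ compatible with $V_i$, i.e. with $t_i\ge t_j+\frac{d_j-o_j}{v_j}+\frac{|o_i-d_j|}{v_0}$ and $\mathrm{PTF}(w(V_j),V_j,V_i)\ge 0$. If $\Phi(V_i)\ne\varnothing$, let $V_*(i)\in\Phi(V_i)$ maximize $\mathrm{PTF}(w(V_j),V_j,V_i)$; add $V_i$ to $N$ with $w(V_i)=\mathrm{PTF}(w(V_*(i)),V_*(i),V_i)$ and add the edge $(V_*(i),V_i)$ with weight $0$. If $\Phi(V_i)=\varnothing$, skip $V_i$. After all rides are processed, add $V_{n+1}$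 to $N$ and, for each other $V_j\in N$, add the edge $(V_j,V_{n+1})$ with weight $$\xi(V_j)=t_j+\frac{d_j-o_j}{v_j}+\frac{a-d_j}{v_0}+\frac{1}{\alpha}\max\Big\{\frac{a-d_j}{v_0}(\beta-\alpha)-\Big(w(V_j)+\alpha\frac{d_j-o_j}{v_j}\Big),0\Big\}.$$ (3) Find $\overline V\in N\setminus\{V_{n+1}\}$ minimizing $w(\overline V,V_{n+1})$; follow edges backwards from $\overline V$ (each node other than $V_0$, $V_{n+1}$ is joined to exactly one node that entered $N$ earlier) until $V_0$ is reached; output the rides found, in the order they joined $N$. *)

theory Defs
  imports Complex_Main "HOL-Library.Landau_Symbols" "HOL-Library.Monad_Syntax"
begin

section \<open>The offline ride-hitching problem\<close>

record uav =
  speed :: real        (* v_0 *)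
  charging :: real     (* alpha *)
  consuming :: real    (* beta *)
  goal :: real         (* a *)
  init_power :: real   (* P_0 *)

definition valid_uav :: "uav \<Rightarrow> bool" where
  "valid_uav D \<longleftrightarrow>
     speed D > 0 \<and> charging D > 0 \<and> consuming D > charging D \<and>
     0 \<le> init_power D \<and>
     init_power D < (consuming D - charging D) * goal D / speed D"

record ride =
  release :: real   (* r_i *)
  depart :: real    (* t_i *)
  origin :: real    (* o_i *)
  dropoff :: real   (* d_i *)
  velocity :: real  (* v_i *)

definition valid_ride :: "uav \<Rightarrow> ride \<Rightarrow> bool" where
  "valid_ride D V \<longleftrightarrow>
     release V \<le> depart V \<and>
     0 \<le> origin V \<and> origin V < dropoff V \<and> dropoff V \<le> goal D \<and> velocity V > 0"

text \<open>For the virtual ride at the source, whose velocity is 0, this is 0 because x / 0 = 0.\<close>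

definition travel_time :: "ride \<Rightarrow> real" where
  "travel_time V = (dropoff V - origin V) / velocity V"

definition ptf :: "uav \<Rightarrow> real \<Rightarrow> ride \<Rightarrow> ride \<Rightarrow> real" where
  "ptf D P V W =
     P + (depart W - depart V) * charging D - \<bar>origin W - dropoff V\<bar> * consuming D / speed D"

definition in_time :: "uav \<Rightarrow> ride \<Rightarrow> ride \<Rightarrow> bool" where
  "in_time D V W \<longleftrightarrow>
     depart W \<ge> depart V + travel_time V + \<bar>origin W - dropoff V\<bar> / speed D"

text \<open>Positions in a sequence are counted from 0, so \<open>power D U i\<close> is the power
  when boarding the ride number \<open>i + 1\<close> of \<open>U\<close>; it is meaningful for \<open>i < length U\<close>.\<close>

primrec power :: "uav \<Rightarrow> ride list \<Rightarrow> nat \<Rightarrow> real" where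
  "power D U 0 =
     init_power D + depart (U ! 0) * charging D - origin (U ! 0) / speed D * consuming D"
| "power D U (Suc i) = ptf D (power D U i) (U ! i) (U ! Suc i)"

definition feasible :: "uav \<Rightarrow> ride list \<Rightarrow> bool" where
  "feasible D U \<longleftrightarrow>
     (U \<noteq> [] \<longrightarrow> depart (U ! 0) \<ge> origin (U ! 0) / speed D \<and> power D U 0 \<ge> 0) \<and>
     (\<forall>i. Suc i < length U \<longrightarrow> in_time D (U ! i) (U ! Suc i) \<and> power D U (Suc i) \<ge> 0)"

definition arrival_time :: "uav \<Rightarrow> ride list \<Rightarrow> real" where
  "arrival_time D U =
     (if U = [] then consuming D / charging D * (goal D / speed D) - init_power D / charging D
      else max
        ((origin (U ! 0) + (\<Sum>i<length U - 1. \<bar>origin (U ! Suc i) - dropoff (U ! i)\<bar>)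
            + goal D - dropoff (last U)) * (consuming D / (charging D * speed D))
          - init_power D / charging D)
        (depart (last U) + travel_time (last U) + (goal D - dropoff (last U)) / speed D))"

definition optimal_offline :: "uav \<Rightarrow> ride set \<Rightarrow> ride list \<Rightarrow> bool" where
  "optimal_offline D R U \<longleftrightarrow>
     set U \<subseteq> R \<and> feasible D U \<and>
     (\<forall>W. set W \<subseteq> R \<and> feasible D W \<longrightarrow> arrival_time D U \<le> arrival_time D W)"

section \<open>Nondeterministic programs with running time\<close>

text \<open>A program is the set of its possible runs, each given by a result and a number of
  elementary steps. Nondeterminism only serves to leave ties open. The cost model is the
  real RAM: every call of a recursive function, every evaluation of an arithmetic expression or
  test of constant size (\<open>compute\<close>) and every comparison of two reals (\<open>branch_le\<close>) takes one
  step. Code that is not charged only inspects or builds a constant number of cells.\<close>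

datatype 'a prog = Prog (runs: "('a \<times> nat) set")

definition return :: "'a \<Rightarrow> 'a prog" where
  "return x = Prog {(x, 0)}"

definition bind_prog :: "'a prog \<Rightarrow> ('a \<Rightarrow> 'b prog) \<Rightarrow> 'b prog" where
  "bind_prog p f = Prog {(y, c + c') | x c y c'. (x, c) \<in> runs p \<and> (y, c') \<in> runs (f x)}"

adhoc_overloading Monad_Syntax.bind \<rightleftharpoons> bind_prog

definition step :: "'a prog \<Rightarrow> 'a prog" where
  "step p = Prog {(x, Suc c) | x c. (x, c) \<in> runs p}"

definition compute :: "'a \<Rightarrow> 'a prog" where
  "compute x = step (return x)"

text \<open>Proceeds with \<open>p\<close> or \<open>q\<close> depending on the order of \<open>x\<close> and \<open>y\<close>; if \<open>x = y\<close>, either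
  of them may be taken.\<close>

definition branch_le :: "real \<Rightarrow> real \<Rightarrow> 'a prog \<Rightarrow> 'a prog \<Rightarrow> 'a prog" where
  "branch_le x y p q =
     step (Prog ((if x \<le> y then runs p else {}) \<union> (if y \<le> x then runs q else {})))"

text \<open>A key (an arithmetic expression of constant size) is maximized over \<open>y # xs\<close>.\<close>

fun argmax :: "('a \<Rightarrow> real) \<Rightarrow> 'a \<Rightarrow> 'a list \<Rightarrow> 'a prog" where
  "argmax f y [] = step (return y)"
| "argmax f y (x # xs) = step (do {
     kx \<leftarrow> compute (f x);
     ky \<leftarrow> compute (f y);
     branch_le kx ky (argmax f y xs) (argmax f x xs)
   })"

fun insert_ride :: "ride \<Rightarrow> ride list \<Rightarrow> ride list prog" where
  "insert_ride V [] = step (return [V])"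
| "insert_ride V (W # Ws) = step (
     branch_le (origin V) (origin W)
       (return (V # W # Ws))
       (do { Xs \<leftarrow> insert_ride V Ws; return (W # Xs) }))"

fun sort_rides :: "ride list \<Rightarrow> ride list prog" where
  "sort_rides [] = step (return [])"
| "sort_rides (V # Vs) = step (do { Ws \<leftarrow> sort_rides Vs; insert_ride V Ws })"

section \<open>The algorithm\<close>

text \<open>The node of \<open>V\<^sub>i\<close> consists of its index \<open>i\<close>, the ride and the node weight. The node and
  edge lists of the graph are kept with the most recent entry first.\<close>

datatype node = Node (idx: nat) (ride_of: ride) (weight: real)

type_synonym edge = "node \<times> node \<times> real"

definition source_ride :: ride where
  "source_ride = \<lparr>release = 0, depart = 0, origin = 0, dropoff = 0, velocity = 0\<rparr>"

text \<open>The goal node is only needed as the head of the edges into it, so it is not consed to the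
  node list. Its index is \<open>n + 1\<close>; its ride and its weight are never used.\<close>

definition goal_node :: "uav \<Rightarrow> nat \<Rightarrow> node" where
  "goal_node D k =
     Node k \<lparr>release = 0, depart = 0, origin = goal D, dropoff = goal D, velocity = 0\<rparr> 0"

definition transfer :: "uav \<Rightarrow> ride \<Rightarrow> node \<Rightarrow> real" where
  "transfer D V u = ptf D (weight u) (ride_of u) V"

definition compatible :: "uav \<Rightarrow> ride \<Rightarrow> node \<Rightarrow> bool" where
  "compatible D V u \<longleftrightarrow> in_time D (ride_of u) V \<and> transfer D V u \<ge> 0"

definition node_arrival :: "uav \<Rightarrow> node \<Rightarrow> real" where
  "node_arrival D u = (let V = ride_of u; rest = (goal D - dropoff V) / speed D in
     depart V + travel_time V + rest +
     1 / charging D *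
       max (rest * (consuming D - charging D) - (weight u + charging D * travel_time V)) 0)"

fun compatible_nodes :: "uav \<Rightarrow> ride \<Rightarrow> node list \<Rightarrow> node list prog" where
  "compatible_nodes D V [] = step (return [])"
| "compatible_nodes D V (u # us) = step (do {
     ok \<leftarrow> compute (compatible D V u);
     \<Phi> \<leftarrow> compatible_nodes D V us;
     return (if ok then u # \<Phi> else \<Phi>)
   })"

text \<open>The counter \<open>i\<close> is the index of the next ride; it is returned together with the graph.\<close>

fun add_rides ::
  "uav \<Rightarrow> nat \<Rightarrow> ride list \<Rightarrow> node list \<Rightarrow> edge list \<Rightarrow> (nat \<times> node list \<times> edge list) prog" where
  "add_rides D i [] N E = step (return (i, N, E))"
| "add_rides D i (V # Vs) N E = step (do {
     \<Phi> \<leftarrow> compatible_nodes D V N;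
     case \<Phi> of
       [] \<Rightarrow> add_rides D (Suc i) Vs N E
     | u # us \<Rightarrow> do {
         best \<leftarrow> argmax (transfer D V) u us;
         p \<leftarrow> compute (transfer D V best);
         add_rides D (Suc i) Vs (Node i V p # N) ((best, Node i V p, 0) # E)
       }
   })"

fun add_goal_edges :: "uav \<Rightarrow> node \<Rightarrow> node list \<Rightarrow> edge list \<Rightarrow> edge list prog" where
  "add_goal_edges D z [] E = step (return E)"
| "add_goal_edges D z (u # us) E = step (do {
     x \<leftarrow> compute (node_arrival D u);
     add_goal_edges D z us ((u, z, x) # E)
   })"

fun edges_into :: "node \<Rightarrow> edge list \<Rightarrow> edge list prog" where
  "edges_into z [] = step (return [])"
| "edges_into z ((u, v, x) # E) = step (do {
     ok \<leftarrow> compute (idx v = idx z);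
     F \<leftarrow> edges_into z E;
     return (if ok then (u, v, x) # F else F)
   })"

text \<open>Follows the edges backwards from \<open>y\<close>. After an edge \<open>(u, y)\<close> only the older edges are
  searched: \<open>u\<close> joined the graph before \<open>y\<close>, hence so did the edge into \<open>u\<close>.
  The rides are collected in front of \<open>acc\<close>, i.e. in the order in which they joined.\<close>

fun trace_back :: "node \<Rightarrow> edge list \<Rightarrow> ride list \<Rightarrow> ride list prog" where
  "trace_back y [] acc = step (return acc)"
| "trace_back y ((u, v, x) # E) acc = step (do {
     at_source \<leftarrow> compute (idx y = 0);
     ok \<leftarrow> compute (idx v = idx y);
     if at_source then return acc
     else if ok then trace_back u E (ride_of y # acc)
     else trace_back y E acc
   })"

text \<open>The node of the source always has an edge to the goal node, so the first case in the last
  branching does not occur.\<close>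

definition optimal_hitching :: "uav \<Rightarrow> ride list \<Rightarrow> ride list prog" where
  "optimal_hitching D Vs = step (do {
     Ws \<leftarrow> sort_rides Vs;
     (k, N, E) \<leftarrow> add_rides D 1 Ws [Node 0 source_ride (init_power D)] [];
     let z = goal_node D k;
     E' \<leftarrow> add_goal_edges D z N E;
     F \<leftarrow> edges_into z E';
     case F of
       [] \<Rightarrow> return []
     | e # es \<Rightarrow> do {
         (y, _, _) \<leftarrow> argmax (\<lambda>(_, _, x). - x) e es;
         trace_back y E' []
       }
   })"

end

theory Submission
  imports Defs "HOL-Real_Asymp.Real_Asymp"
begin

text \<open>If a feasible sequence takes \<open>X\<close> right after \<open>V\<close> although \<open>X\<close> does not start beyond \<open>V\<close>,
  then \<open>V\<close> can be dropped: the UAV gets to \<open>X\<close> with less flying, hence early enough and with at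
  least as much power. So only sequences with strictly increasing origins matter. On those, more
  power at a node never hurts, neither for boarding later rides nor for the arrival time; hence
  remembering for every ride only the maximal power at boarding is enough.\<close>

section \<open>Bounds on results and running times\<close>

text \<open>Nonemptiness keeps the bound from holding vacuously for a program without runs. The rest
  ranges over all runs, so every way of breaking ties is covered.\<close>

definition ensures :: "'a prog \<Rightarrow> nat \<Rightarrow> ('a \<Rightarrow> bool) \<Rightarrow> bool" where
  "ensures p b Q \<longleftrightarrow> runs p \<noteq> {} \<and> (\<forall>(x, c)\<in>runs p. c \<le> b \<and> Q x)"

lemma ensures_mono:
  assumes "ensures p b Q" "b \<le> b'" "\<And>x. Q x \<Longrightarrow> Q' x"
  shows "ensures p b' Q'"
  using assms unfolding ensures_def by fastforce

lemma ensures_return: "Q x \<Longrightarrow> ensures (return x) b Q"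
  by (simp add: ensures_def return_def)

lemma ensures_step: "ensures p b Q \<Longrightarrow> ensures (step p) (Suc b) Q"
  by (fastforce simp: ensures_def step_def)

lemma ensures_bind:
  assumes "ensures p b Q" "\<And>x. Q x \<Longrightarrow> ensures (f x) b' R"
  shows "ensures (bind_prog p f) (b + b') R"
proof -
  obtain x c where "(x, c) \<in> runs p" "Q x"
    using assms(1) unfolding ensures_def by fastforce
  moreover from assms(2)[OF this(2)] obtain y c' where "(y, c') \<in> runs (f x)"
    unfolding ensures_def by fastforce
  ultimately have "(y, c + c') \<in> runs (bind_prog p f)"
    unfolding bind_prog_def prog.sel by blast
  then have "runs (bind_prog p f) \<noteq> {}"
    by blast
  moreover have "c \<le> b + b' \<and> R y" if yc: "(y, c) \<in> runs (bind_prog p f)" for y c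
  proof -
    from yc obtain x c1 c2 where "(x, c1) \<in> runs p" "(y, c2) \<in> runs (f x)" "c = c1 + c2"
      by (auto simp: bind_prog_def)
    with assms show ?thesis
      unfolding ensures_def by (fastforce intro: add_mono)
  qed
  ultimately show ?thesis
    by (auto simp: ensures_def)
qed

lemma ensures_compute_bind:
  assumes "ensures (f x) b Q"
  shows "ensures (bind_prog (compute x) f) (Suc b) Q"
proof -
  have "ensures (compute x) 1 (\<lambda>y. y = x)"
    by (simp add: ensures_def compute_def step_def return_def)
  from ensures_bind[OF this] assms show ?thesis
    by fastforce
qed

text \<open>Linearity of the order guarantees that at least one branch has runs; under a tie both
  are possible, and then both premises apply.\<close>

lemma ensures_branch_le:
  assumes "x \<le> y \<Longrightarrow> ensures p b Q" "y \<le> x \<Longrightarrow> ensures q b Q"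
  shows "ensures (branch_le x y p q) (Suc b) Q"
  unfolding branch_le_def
proof (rule ensures_step)
  show "ensures (Prog ((if x \<le> y then runs p else {}) \<union> (if y \<le> x then runs q else {}))) b Q"
    using assms unfolding ensures_def by (cases x y rule: linorder_cases) auto
qed

section \<open>Results and costs of the subroutines\<close>

lemma argmax_ensures:
  "ensures (argmax f y xs) (4 * length xs + 1)
     (\<lambda>z. z \<in> set (y # xs) \<and> (\<forall>x\<in>set (y # xs). f x \<le> f z))"
proof (induction f y xs rule: argmax.induct)
  case (1 f y)
  show ?case
    by (auto intro!: ensures_step ensures_return)
next
  case (2 f y x xs)
  \<comment> \<open>Four steps per list element: the call, two key evaluations and the
    comparison.\<close>
  have "ensures (argmax f y (x # xs)) (Suc (Suc (Suc (Suc (4 * length xs + 1)))))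
     (\<lambda>z. z \<in> set (y # x # xs) \<and> (\<forall>w\<in>set (y # x # xs). f w \<le> f z))"
    unfolding argmax.simps(2)
    by (intro ensures_step ensures_compute_bind ensures_branch_le)
      (rule ensures_mono[OF 2(1)] ensures_mono[OF 2(2)]; force)+
  then show ?case
    by (rule ensures_mono) auto
qed

lemma insert_ride_ensures:
  assumes "sorted_wrt (\<lambda>V W. origin V \<le> origin W) Ws"
  shows "ensures (insert_ride V Ws) (2 * length Ws + 1)
     (\<lambda>Xs. set Xs = insert V (set Ws) \<and> length Xs = Suc (length Ws) \<and>
        sorted_wrt (\<lambda>V W. origin V \<le> origin W) Xs)"
  using assms
proof (induction V Ws rule: insert_ride.induct)
  case (1 V)
  show ?case
    by (auto intro!: ensures_step ensures_return)
next
  case (2 V W Ws)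
  have "ensures (insert_ride V (W # Ws)) (Suc (Suc ((2 * length Ws + 1) + 0)))
     (\<lambda>Xs. set Xs = insert V (set (W # Ws)) \<and> length Xs = Suc (length (W # Ws)) \<and>
        sorted_wrt (\<lambda>V W. origin V \<le> origin W) Xs)"
    unfolding insert_ride.simps(2)
    by (intro ensures_step ensures_branch_le ensures_return ensures_bind[OF 2(1)])
      (use 2(2) in auto)
  then show ?case
    by (rule ensures_mono) auto
qed

text \<open>Insertion sort. Multiplicities are not tracked: optimality speaks of the set of rides
  only, and the length suffices for the costs.\<close>

lemma sort_rides_ensures:
  "ensures (sort_rides Vs) (length Vs * (2 * length Vs + 2) + 1)
     (\<lambda>Ws. set Ws = set Vs \<and> length Ws = length Vs \<and>
        sorted_wrt (\<lambda>V W. origin V \<le> origin W) Ws)"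
proof (induction Vs)
  case Nil
  show ?case
    by (auto intro!: ensures_step ensures_return)
next
  case (Cons V Vs)
  have "ensures (sort_rides (V # Vs))
     (Suc ((length Vs * (2 * length Vs + 2) + 1) + (2 * length Vs + 1)))
     (\<lambda>Ws. set Ws = set (V # Vs) \<and> length Ws = length (V # Vs) \<and>
        sorted_wrt (\<lambda>V W. origin V \<le> origin W) Ws)"
    unfolding sort_rides.simps(2)
  proof (intro ensures_step ensures_bind[OF Cons])
    fix Ws
    assume "set Ws = set Vs \<and> length Ws = length Vs \<and>
      sorted_wrt (\<lambda>V W. origin V \<le> origin W) Ws"
    then show "ensures (insert_ride V Ws) (2 * length Vs + 1)
      (\<lambda>Ws. set Ws = set (V # Vs) \<and> length Ws = length (V # Vs) \<and>
        sorted_wrt (\<lambda>V W. origin V \<le> origin W) Ws)"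
      using insert_ride_ensures[of Ws V] by auto
  qed
  then show ?case
    by (rule ensures_mono) auto
qed

lemma compatible_nodes_ensures:
  "ensures (compatible_nodes D V N) (2 * length N + 1) (\<lambda>\<Phi>. \<Phi> = filter (compatible D V) N)"
proof (induction N)
  case Nil
  show ?case
    by (auto intro!: ensures_step ensures_return)
next
  case (Cons u us)
  have "ensures (compatible_nodes D V (u # us)) (Suc (Suc ((2 * length us + 1) + 0)))
     (\<lambda>\<Phi>. \<Phi> = filter (compatible D V) (u # us))"
    unfolding compatible_nodes.simps(2)
    by (intro ensures_step ensures_compute_bind ensures_bind[OF Cons] ensures_return) auto
  then show ?case
    by (rule ensures_mono) auto
qed

lemma add_goal_edges_ensures:
  "ensures (add_goal_edges D z N E) (2 * length N + 1)
     (\<lambda>E'. E' = map (\<lambda>u. (u, z, node_arrival D u)) (rev N) @ E)"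
proof (induction D z N E rule: add_goal_edges.induct)
  case (1 D z E)
  show ?case
    by (auto intro!: ensures_step ensures_return)
next
  case (2 D z u us E)
  have "ensures (add_goal_edges D z (u # us) E) (Suc (Suc (2 * length us + 1)))
     (\<lambda>E'. E' = map (\<lambda>u. (u, z, node_arrival D u)) (rev (u # us)) @ E)"
    unfolding add_goal_edges.simps(2)
    by (intro ensures_step ensures_compute_bind) (rule ensures_mono[OF 2]; simp)
  then show ?case
    by (rule ensures_mono) auto
qed

lemma edges_into_ensures:
  "ensures (edges_into z E) (2 * length E + 1) (\<lambda>F. F = filter (\<lambda>(u, v, x). idx v = idx z) E)"
proof (induction z E rule: edges_into.induct)
  case (1 z)
  show ?case
    by (auto intro!: ensures_step ensures_return)
next
  case (2 z u v x E)
  have "ensures (edges_into z ((u, v, x) # E)) (Suc (Suc ((2 * length E + 1) + 0)))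
     (\<lambda>F. F = filter (\<lambda>(u, v, x). idx v = idx z) ((u, v, x) # E))"
    unfolding edges_into.simps(2)
    by (intro ensures_step ensures_compute_bind ensures_bind[OF 2] ensures_return) auto
  then show ?case
    by (rule ensures_mono) auto
qed

section \<open>Tracing edges back to the source\<close>

fun trace :: "node \<Rightarrow> edge list \<Rightarrow> ride list" where
  "trace y [] = []"
| "trace y ((u, v, x) # E) =
     (if idx y = 0 then []
      else if idx v = idx y then trace u E @ [ride_of y]
      else trace y E)"

lemma trace_source: "idx y = 0 \<Longrightarrow> trace y E = []"
  by (induction y E rule: trace.induct) auto

text \<open>If \<open>y\<close> has index 0, both sides are empty by \<open>trace_source\<close>;
  otherwise the edge is skipped.\<close>

lemma trace_Cons_other: "idx v \<noteq> idx y \<Longrightarrow> trace y ((u, v, x) # E) = trace y E"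
  by (simp add: trace_source)

text \<open>Lets a trace ignore the edges to the goal node, which stand in front of the edges
  between rides.\<close>

lemma trace_append_other:
  "\<forall>(u, v, x)\<in>set E'. idx v \<noteq> idx y \<Longrightarrow> trace y (E' @ E) = trace y E"
  by (induction E') (auto simp: trace_source)

text \<open>\<open>trace\<close> is the loop without accumulator and costs. It appends each ride at
  the end, so the snoc rules for feasibility and power apply to it. Each edge costs three steps: the
  call and two tests.\<close>

lemma trace_back_ensures:
  "ensures (trace_back y E acc) (3 * length E + 1) (\<lambda>U. U = trace y E @ acc)"
proof (induction y E acc rule: trace_back.induct)
  case (1 y acc)
  show ?case
    by (auto intro!: ensures_step ensures_return)
next
  case (2 y u v x E acc)
  have "ensures (trace_back y ((u, v, x) # E) acc) (Suc (Suc (Suc (3 * length E + 1))))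
     (\<lambda>U. U = trace y ((u, v, x) # E) @ acc)"
    unfolding trace_back.simps(2)
    by (intro ensures_step ensures_compute_bind) (use 2 in \<open>auto intro: ensures_return\<close>)
  then show ?case
    by (rule ensures_mono) auto
qed

section \<open>Feasible sequences\<close>

text \<open>With the source as the ride before the first one, all rides of a sequence are treated
  alike.\<close>

definition last_ride :: "ride list \<Rightarrow> ride" where
  "last_ride U = last (source_ride # U)"

definition end_power :: "uav \<Rightarrow> ride list \<Rightarrow> real" where
  "end_power D U = (if U = [] then init_power D else power D U (length U - 1))"

lemma last_ride_simps [simp]:
  "last_ride [] = source_ride" "last_ride (U @ [V]) = V"
  by (simp_all add: last_ride_def)

lemma end_power_Nil [simp]: "end_power D [] = init_power D"
  by (simp add: end_power_def)

lemma power_append: "i < length U \<Longrightarrow> power D (U @ W) i = power D U i"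
  by (induction i) (auto simp: nth_append)

text \<open>For empty \<open>U\<close> the transfer starts at the source, which departs at time 0
  from position 0; as \<open>origin V\<close> is nonnegative, the absolute value disappears and the
  formula for the first ride remains.\<close>

lemma end_power_snoc:
  assumes "0 \<le> origin V"
  shows "end_power D (U @ [V]) = ptf D (end_power D U) (last_ride U) V"
proof (cases U)
  case Nil
  with assms show ?thesis
    by (simp add: end_power_def ptf_def source_ride_def)
next
  case (Cons V' U')
  then have "length U = Suc (length U')"
    by simp
  moreover from this Cons have "U ! length U' = last_ride U"
    by (simp add: last_ride_def last_conv_nth)
  ultimately show ?thesis
    by (simp add: end_power_def nth_append power_append del: power.simps(1))
      (use Cons in auto)
qed

lemma feasible_Nil [simp]: "feasible D []"
  by (simp add: feasible_def)

text \<open>Turns feasibility into a recursion at the end of the sequence, matching the way the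
  graph grows. For empty \<open>U\<close> it relies on the source having travel time 0.\<close>

lemma feasible_snoc:
  assumes "0 \<le> origin V"
  shows "feasible D (U @ [V]) \<longleftrightarrow>
    feasible D U \<and> in_time D (last_ride U) V \<and> ptf D (end_power D U) (last_ride U) V \<ge> 0"
proof (cases "U = []")
  case True
  with assms show ?thesis
    by (simp add: feasible_def in_time_def ptf_def source_ride_def travel_time_def)
next
  case False
  define k where "k = length U - 1"
  have k: "length U = Suc k"
    using False by (simp add: k_def)
  have last: "last_ride U = U ! k"
    using False by (simp add: last_ride_def last_conv_nth k_def)
  have pw: "end_power D U = power D U k"
    using False by (simp add: end_power_def k_def)
  \<comment> \<open>Index \<open>k\<close> is the one new transition, from the last ride of
    \<open>U\<close> to \<open>V\<close>.\<close>
  have split: "(\<forall>i. Suc i < length (U @ [V]) \<longrightarrow> P i) \<longleftrightarrow> (\<forall>i. Suc i < length U \<longrightarrow> P i) \<and> P k" for P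
    using k by (auto simp: less_Suc_eq)
  have old: "Suc i < length U \<Longrightarrow> power D (U @ [V]) (Suc i) = power D U (Suc i)"
    "Suc i < length U \<Longrightarrow> (U @ [V]) ! i = U ! i"
    "Suc i < length U \<Longrightarrow> (U @ [V]) ! Suc i = U ! Suc i" for i
    by (auto simp: nth_append power_append simp del: power.simps)
  have new: "power D (U @ [V]) 0 = power D U 0" "(U @ [V]) ! 0 = U ! 0"
    "(U @ [V]) ! k = U ! k" "(U @ [V]) ! Suc k = V"
    "power D (U @ [V]) (Suc k) = ptf D (power D U k) (U ! k) V"
    using k by (auto simp: nth_append power_append simp del: power.simps(1))
  show ?thesis
    unfolding feasible_def split last pw new using False old by (auto simp del: power.simps)
qed

section \<open>Closed forms for power and arrival time\<close>

lemma end_power_eq: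
  assumes "\<forall>V\<in>set U. 0 \<le> origin V" "U \<noteq> []"
  shows "end_power D U = init_power D + depart (last U) * charging D -
    (origin (U ! 0) + (\<Sum>i<length U - 1. \<bar>origin (U ! Suc i) - dropoff (U ! i)\<bar>))
      * consuming D / speed D"
  using assms
proof (induction U rule: rev_induct)
  case Nil
  then show ?case
    by simp
next
  case (snoc V U)
  show ?case
  proof (cases "U = []")
    case True
    then show ?thesis
      by (simp add: end_power_def)
  next
    case False
    then obtain k where k: "length U = Suc k"
      by (cases U) auto
    have last: "last U = U ! k" "last_ride U = last U"
      using False k by (simp_all add: last_ride_def last_conv_nth)
    have sum: "(\<Sum>i<Suc k. \<bar>origin ((U @ [V]) ! Suc i) - dropoff ((U @ [V]) ! i)\<bar>) =
      (\<Sum>i<k. \<bar>origin (U ! Suc i) - dropoff (U ! i)\<bar>) + \<bar>origin V - dropoff (last U)\<bar>"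
      using k last by (simp add: nth_append)
    have "(U @ [V]) ! 0 = U ! 0"
      using k by (simp add: nth_append)
    \<comment> \<open>Appending \<open>V\<close> adds \<open>depart V - depart (last U)\<close> to
      the charging time and one summand to the distance flown, so the departure times telescope to
      the last one.\<close>
    with snoc.IH[OF _ False] snoc.prems k sum last(2) show ?thesis
      by (simp add: end_power_snoc ptf_def algebra_simps add_divide_distrib del: sum.lessThan_Suc)
  qed
qed

text \<open>Pulls the maximum outwards. Its first argument is the arrival without waiting for power;
  the second is the time at which the energy charged since boarding, plus the node weight, just pays
  for the remaining flight.\<close>

lemma node_arrival_eq:
  assumes "charging D > 0"
  shows "node_arrival D u = max
    (depart (ride_of u) + travel_time (ride_of u) + (goal D - dropoff (ride_of u)) / speed D)
    (depart (ride_of u) + (goal D - dropoff (ride_of u)) / speed D * (consuming D / charging D)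
      - weight u / charging D)"
proof -
  have "1 / charging D * max x 0 = max (x / charging D) 0" for x
    using assms by (auto simp: max_def field_simps)
  moreover have "s + t + r + max ((r * (consuming D - charging D) - (w + charging D * t)) / charging D) 0
    = max (s + t + r) (s + r * (consuming D / charging D) - w / charging D)" for r s t w
  proof -
    have "(r * (consuming D - charging D) - (w + charging D * t)) / charging D
      = r * (consuming D / charging D) - w / charging D - r - t"
      using assms by (simp add: field_simps)
    then show ?thesis
      by (simp add: max_def)
  qed
  ultimately show ?thesis
    by (simp add: node_arrival_def Let_def)
qed

lemma node_arrival_antimono:
  assumes "charging D > 0" "ride_of u = ride_of u'" "weight u' \<le> weight u"
  shows "node_arrival D u \<le> node_arrival D u'"
proof -
  have "weight u' / charging D \<le> weight u / charging D"
    using assms by (simp add: divide_right_mono)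
  with assms(1,2) show ?thesis
    by (simp add: node_arrival_eq max_def)
qed

text \<open>Links the objective of the problem, which looks at the whole sequence, to the weight of
  the edge into the goal, which looks only at the last ride and the power when boarding it.\<close>

lemma arrival_time_eq_node_arrival:
  assumes "valid_uav D" "\<forall>V\<in>set U. 0 \<le> origin V"
    and "ride_of u = last_ride U" "weight u = end_power D U"
  shows "arrival_time D U = node_arrival D u"
proof (cases "U = []")
  case True
  \<comment> \<open>The upper bound on the initial power makes the energy term the larger one, which
    is why the arrival time of the empty sequence contains no maximum.\<close>
  from assms(1) have "init_power D * speed D < (consuming D - charging D) * goal D"
    by (metis valid_uav_def pos_less_divide_eq)
  with assms(1) have "goal D / speed D \<le> goal D / speed D * (consuming D / charging D)
      - init_power D / charging D"
    by (simp add: valid_uav_def field_simps)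
  with True assms show ?thesis
    by (simp add: node_arrival_eq arrival_time_def valid_uav_def source_ride_def
        travel_time_def max_def mult.commute)
next
  case False
  have pos: "charging D > 0" "speed D > 0"
    using assms(1) by (simp_all add: valid_uav_def)
  define d where
    "d = origin (U ! 0) + (\<Sum>i<length U - 1. \<bar>origin (U ! Suc i) - dropoff (U ! i)\<bar>)"
  have w: "weight u = init_power D + depart (last U) * charging D - d * consuming D / speed D"
    using end_power_eq[OF assms(2) False] assms(4) by (simp add: d_def)
  \<comment> \<open>The departure time cancels against the charging up to it inside
    \<open>weight u\<close>; what remains depends only on the distance flown and the initial
    power.\<close>
  have "depart (last U) + (goal D - dropoff (last U)) / speed D * (consuming D / charging D)
      - weight u / charging D =
    (d + goal D - dropoff (last U)) * (consuming D / (charging D * speed D))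
      - init_power D / charging D"
    using pos unfolding w by (simp add: field_simps)
  moreover have "ride_of u = last U"
    using assms(3) False by (simp add: last_ride_def)
  ultimately show ?thesis
    using False pos by (simp add: node_arrival_eq arrival_time_def d_def max.commute)
qed

section \<open>Reduction to sequences with increasing origins\<close>

lemma ptf_mono: "P \<le> P' \<Longrightarrow> ptf D P V W \<le> ptf D P' V W"
  by (simp add: ptf_def)

text \<open>The direct flight from \<open>Y\<close> to \<open>X\<close> is no longer than the two
  flights via \<open>V\<close>, and the charging times from \<open>Y\<close> to \<open>V\<close> and
  from \<open>V\<close> to \<open>X\<close> add up to that from \<open>Y\<close> to
  \<open>X\<close>.\<close>

lemma drop_ride:
  assumes "speed D > 0" "consuming D \<ge> 0" "valid_ride D V" "origin X \<le> origin V"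
    and "in_time D Y V" "in_time D V X"
  shows "in_time D Y X" "ptf D (ptf D P Y V) V X \<le> ptf D P Y X"
proof -
  \<comment> \<open>Triangle inequality through \<open>origin V\<close>: as \<open>V\<close> carries
    the UAV away from \<open>X\<close>, the distance from \<open>origin V\<close> to
    \<open>origin X\<close> is at most that from \<open>dropoff V\<close>.\<close>
  have "\<bar>origin X - dropoff Y\<bar> \<le> \<bar>origin V - dropoff Y\<bar> + \<bar>origin X - dropoff V\<bar>"
    using assms(3,4) by (auto simp: valid_ride_def)
  then have flight: "\<bar>origin X - dropoff Y\<bar> / speed D
    \<le> \<bar>origin V - dropoff Y\<bar> / speed D + \<bar>origin X - dropoff V\<bar> / speed D"
    using assms(1) by (metis add_divide_distrib divide_right_mono less_imp_le)
  moreover have "travel_time V \<ge> 0"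
    using assms(3) by (simp add: valid_ride_def travel_time_def)
  ultimately show "in_time D Y X"
    using assms(5,6) by (simp add: in_time_def)
  have "\<bar>origin X - dropoff Y\<bar> * consuming D / speed D \<le>
    \<bar>origin V - dropoff Y\<bar> * consuming D / speed D + \<bar>origin X - dropoff V\<bar> * consuming D / speed D"
    using mult_left_mono[OF flight assms(2)] by (simp add: algebra_simps)
  then show "ptf D (ptf D P Y V) V X \<le> ptf D P Y X"
    by (simp add: ptf_def algebra_simps)
qed

abbreviation increasing :: "ride list \<Rightarrow> bool" where
  "increasing \<equiv> sorted_wrt (\<lambda>V W. origin V < origin W)"

text \<open>Rides are removed from the end of \<open>U\<close> by \<open>drop_ride\<close> until the
  last one left starts before \<open>X\<close>. Since \<open>U\<close> is increasing, all earlier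
  ones then do so too.\<close>

lemma increasing_snoc_exists:
  assumes "valid_uav D" "\<forall>V\<in>set (U @ [X]). valid_ride D V"
    and "increasing U" "feasible D (U @ [X])"
  shows "\<exists>W. set W \<subseteq> set U \<and> increasing (W @ [X]) \<and> feasible D (W @ [X]) \<and>
    end_power D (U @ [X]) \<le> end_power D (W @ [X])"
  using assms(2-4)
proof (induction U rule: rev_induct)
  case Nil
  then show ?case
    by (intro exI[of _ "[]"]) simp
next
  case (snoc V U)
  show ?case
  proof (cases "origin V < origin X")
    case True
    with snoc.prems show ?thesis
      by (intro exI[of _ "U @ [V]"]) (force simp: sorted_wrt_append)
  next
    case False
    have origin: "0 \<le> origin V" "0 \<le> origin X" and V: "valid_ride D V"
      using snoc.prems(1) by (auto simp: valid_ride_def)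
    have D: "speed D > 0" "consuming D \<ge> 0"
      using assms(1) by (auto simp: valid_uav_def)
    have feas: "feasible D U" "in_time D (last_ride U) V" "in_time D V X"
      and pw: "0 \<le> ptf D (ptf D (end_power D U) (last_ride U) V) V X"
      using snoc.prems(3) feasible_snoc[OF origin(2), of D "U @ [V]"]
      by (simp_all add: origin feasible_snoc end_power_snoc)
    note drop = drop_ride[OF D V _ feas(2,3), OF leI[OF False]]
    have "feasible D (U @ [X])"
      using feas drop(1) order_trans[OF pw drop(2)] by (simp add: origin feasible_snoc)
    moreover have "end_power D ((U @ [V]) @ [X]) \<le> end_power D (U @ [X])"
      using drop(2) end_power_snoc[OF origin(2), of D "U @ [V]"]
      by (simp add: origin end_power_snoc)
    ultimately show ?thesis
      using snoc.IH snoc.prems(1,2) by (fastforce simp: sorted_wrt_append)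
  qed
qed

text \<open>The prefix is made increasing first; its replacement has the same last ride and at least
  the same power, so \<open>X\<close> can still follow, and \<open>increasing_snoc_exists\<close>
  repairs the order at \<open>X\<close>. Keeping the last ride and not losing power is all that
  later comparisons of arrival times require.\<close>

lemma increasing_exists:
  assumes "valid_uav D" "\<forall>V\<in>set U. valid_ride D V" "feasible D U"
  shows "\<exists>W. set W \<subseteq> set U \<and> increasing W \<and> feasible D W \<and>
    last_ride W = last_ride U \<and> end_power D U \<le> end_power D W"
  using assms(2,3)
proof (induction U rule: rev_induct)
  case Nil
  then show ?case
    by (intro exI[of _ "[]"]) simp
next
  case (snoc X U)
  have origin: "0 \<le> origin X"
    using snoc.prems(1) by (auto simp: valid_ride_def)
  have feas: "feasible D U" "in_time D (last_ride U) X"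
    and pw: "0 \<le> ptf D (end_power D U) (last_ride U) X"
    using snoc.prems(2) by (simp_all add: origin feasible_snoc)
  then obtain W where W: "set W \<subseteq> set U" "increasing W" "feasible D W"
    "last_ride W = last_ride U" "end_power D U \<le> end_power D W"
    using snoc by auto
  have le: "ptf D (end_power D U) (last_ride U) X \<le> ptf D (end_power D W) (last_ride W) X"
    using W(4,5) by (simp add: ptf_mono)
  have "feasible D (W @ [X])"
    using W feas order_trans[OF pw le] by (simp add: origin feasible_snoc)
  moreover have "\<forall>V\<in>set (W @ [X]). valid_ride D V"
    using W(1) snoc.prems(1) by auto
  ultimately obtain W' where "set W' \<subseteq> set W" "increasing (W' @ [X])" "feasible D (W' @ [X])"
    "end_power D (W @ [X]) \<le> end_power D (W' @ [X])"
    using increasing_snoc_exists[OF assms(1) _ W(2)] by blast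
  then show ?case
    using W(1) le by (intro exI[of _ "W' @ [X]"]) (auto simp: origin end_power_snoc)
qed

section \<open>The graph\<close>

text \<open>The invariant that each weight is attained by the sequence traced from its node. The
  index bounds make \<open>i\<close> a fresh index that differs from that of the source.\<close>

definition sound_graph :: "uav \<Rightarrow> ride set \<Rightarrow> nat \<Rightarrow> node list \<Rightarrow> edge list \<Rightarrow> bool" where
  "sound_graph D R i N E \<longleftrightarrow>
     0 < i \<and> (\<forall>(u, v, x)\<in>set E. idx v < i) \<and>
     (\<forall>u\<in>set N. idx u < i \<and> set (trace u E) \<subseteq> R \<and> feasible D (trace u E) \<and>
        last_ride (trace u E) = ride_of u \<and> end_power D (trace u E) = weight u)"

text \<open>The converse invariant: each increasing feasible sequence is dominated by a node with
  the same last ride.\<close>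

definition complete_graph :: "uav \<Rightarrow> ride set \<Rightarrow> node list \<Rightarrow> bool" where
  "complete_graph D R N \<longleftrightarrow>
     (\<forall>U. set U \<subseteq> R \<and> increasing U \<and> feasible D U \<longrightarrow>
        (\<exists>u\<in>set N. ride_of u = last_ride U \<and> end_power D U \<le> weight u))"

section \<open>Preserving the invariants when a ride is processed\<close>

lemma sound_graph_skip:
  "sound_graph D R i N E \<Longrightarrow> R \<subseteq> R' \<Longrightarrow> sound_graph D R' (Suc i) N E"
  unfolding sound_graph_def by fastforce

text \<open>The new edge has a head with fresh index \<open>i\<close>, so old traces do not change,
  and the trace of the new node is that of \<open>best\<close> followed by \<open>V\<close>.\<close>

lemma sound_graph_extend:
  assumes sound: "sound_graph D R i N E" and best: "best \<in> set N" "compatible D V best"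
    and origin: "0 \<le> origin V"
  shows "sound_graph D (insert V R) (Suc i)
    (Node i V (transfer D V best) # N) ((best, Node i V (transfer D V best), 0) # E)"
    (is "sound_graph _ _ _ (?v # N) (?e # E)")
proof -
  have new: "trace ?v (?e # E) = trace best E @ [V]"
    using sound by (simp add: sound_graph_def)
  have old: "trace u (?e # E) = trace u E" if "u \<in> set N" for u
    using sound that by (intro trace_Cons_other) (auto simp: sound_graph_def)
  show ?thesis
    unfolding sound_graph_def list.set ball_simps(7) new
    using sound best old origin
    by (fastforce simp: sound_graph_def compatible_def transfer_def feasible_snoc end_power_snoc
        simp del: trace.simps)
qed

text \<open>No available ride starts beyond \<open>V\<close>, so nothing can follow \<open>V\<close>
  in a strictly increasing sequence. Strictness also settles rides with equal origins.\<close>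

lemma increasing_insert_last:
  assumes "increasing U" "set U \<subseteq> insert V R" "\<forall>W\<in>R. origin W \<le> origin V"
    and "\<not> set U \<subseteq> R"
  obtains U' where "U = U' @ [V]" "set U' \<subseteq> R" "increasing U'"
proof -
  from assms(2,4) have "V \<in> set U"
    by auto
  then obtain U' Us where U: "U = U' @ V # Us"
    by (auto dest: split_list)
  have "Us = []"
  proof (rule ccontr)
    assume "Us \<noteq> []"
    then obtain W where "W \<in> set Us"
      by (cases Us) auto
    with U assms(1-3) show False
      by (fastforce simp: sorted_wrt_append)
  qed
  with U assms(1,2) show ?thesis
    by (intro that[of U']) (auto simp: sorted_wrt_append)
qed

text \<open>Stated for an arbitrary larger \<open>N'\<close> to cover both a skipped and an added
  ride. A sequence ending in \<open>V\<close> is dominated by extending the node that dominates its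
  prefix.\<close>

lemma complete_graph_insert:
  assumes complete: "complete_graph D R N"
    and origin: "0 \<le> origin V" "\<forall>W\<in>R. origin W \<le> origin V"
    and N': "set N \<subseteq> set N'"
    and new: "\<And>u. u \<in> set N \<Longrightarrow> compatible D V u \<Longrightarrow>
      \<exists>v\<in>set N'. ride_of v = V \<and> transfer D V u \<le> weight v"
  shows "complete_graph D (insert V R) N'"
  unfolding complete_graph_def
proof (intro allI impI, elim conjE)
  fix U
  assume U: "set U \<subseteq> insert V R" "increasing U" "feasible D U"
  show "\<exists>u\<in>set N'. ride_of u = last_ride U \<and> end_power D U \<le> weight u"
  proof (cases "set U \<subseteq> R")
    case True
    then show ?thesis
      using complete U N' unfolding complete_graph_def by blast
  next
    case False
    then obtain U' where U': "U = U' @ [V]" "set U' \<subseteq> R" "increasing U'"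
      using increasing_insert_last U origin by metis
    have feas: "feasible D U'" "in_time D (last_ride U') V"
      and pw: "0 \<le> ptf D (end_power D U') (last_ride U') V"
      using U(3) U'(1) origin(1) by (simp_all add: feasible_snoc)
    then obtain u where u: "u \<in> set N" "ride_of u = last_ride U'" "end_power D U' \<le> weight u"
      using complete U' unfolding complete_graph_def by blast
    have le: "ptf D (end_power D U') (last_ride U') V \<le> transfer D V u"
      using u by (simp add: transfer_def ptf_mono)
    \<comment> \<open>The weight of \<open>u\<close> may stem from another sequence than
      \<open>U'\<close>, but it is at least as large, so the transfer to \<open>V\<close> stays
      nonnegative.\<close>
    then have "compatible D V u"
      using u feas pw by (simp add: compatible_def)
    then obtain v where "v \<in> set N'" "ride_of v = V" "transfer D V u \<le> weight v"
      using new u(1) by blast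
    with le show ?thesis
      using U'(1) origin(1) by (intro bexI[of _ v]) (auto simp: end_power_snoc)
  qed
qed

text \<open>\<open>R\<close> holds the rides already processed. Per ride, filtering costs about two
  steps per node and maximizing four; the number of nodes never exceeds
  \<open>length N + length Vs\<close>.\<close>

lemma add_rides_ensures:
  assumes "sound_graph D R i N E" "complete_graph D R N"
    and "sorted_wrt (\<lambda>V W. origin V \<le> origin W) Vs"
    and "\<forall>V\<in>set Vs. 0 \<le> origin V \<and> (\<forall>W\<in>R. origin W \<le> origin V)"
  shows "ensures (add_rides D i Vs N E) (length Vs * (6 * (length N + length Vs) + 4) + 1)
    (\<lambda>(k, N', E'). sound_graph D (R \<union> set Vs) k N' E' \<and> complete_graph D (R \<union> set Vs) N' \<and>
       length N' \<le> length N + length Vs \<and> length E' \<le> length E + length Vs)"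
  using assms
proof (induction Vs arbitrary: i N E R)
  case Nil
  then show ?case
    by (auto intro!: ensures_step ensures_return)
next
  case (Cons V Vs)
  define Q where "Q = (\<lambda>(k, N', E'). sound_graph D (R \<union> set (V # Vs)) k N' E' \<and>
    complete_graph D (R \<union> set (V # Vs)) N' \<and>
    length N' \<le> length N + length (V # Vs) \<and> length E' \<le> length E + length (V # Vs))"
  \<comment> \<open>Bounds the recursive call in both cases: an added ride moves from the list to
    the nodes and leaves the sum of the two lengths unchanged.\<close>
  define b where "b = length Vs * (6 * (length N + length (V # Vs)) + 4) + 1"
  have origin: "0 \<le> origin V" "\<forall>W\<in>R. origin W \<le> origin V"
    using Cons.prems(4) by auto
  have rest: "sorted_wrt (\<lambda>V W. origin V \<le> origin W) Vs"
    "\<forall>X\<in>set Vs. 0 \<le> origin X \<and> (\<forall>W\<in>insert V R. origin W \<le> origin X)"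
    using Cons.prems(3,4) by auto
  have main: "ensures (case filter (compatible D V) N of
       [] \<Rightarrow> add_rides D (Suc i) Vs N E
     | u # us \<Rightarrow> bind_prog (argmax (transfer D V) u us) (\<lambda>best.
         bind_prog (compute (transfer D V best)) (\<lambda>p.
         add_rides D (Suc i) Vs (Node i V p # N) ((best, Node i V p, 0) # E))))
     ((4 * length N + 1) + Suc b) Q"
  proof (cases "filter (compatible D V) N")
    case Nil
    \<comment> \<open>Without a compatible node, the last premise of
      \<open>complete_graph_insert\<close> is vacuous.\<close>
    have "complete_graph D (insert V R) N"
    proof (rule complete_graph_insert[OF Cons.prems(2) origin])
      fix u assume "u \<in> set N" "compatible D V u"
      with Nil show "\<exists>v\<in>set N. ride_of v = V \<and> transfer D V u \<le> weight v"
        by (auto simp: filter_empty_conv)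
    qed simp
    from Cons.IH[OF sound_graph_skip[OF Cons.prems(1) subset_insertI] this rest]
    show ?thesis
      unfolding Nil list.case
      by (rule ensures_mono) (auto simp: Q_def b_def add_mult_distrib2)
  next
    case (Cons u us)
    let ?v = "\<lambda>best. Node i V (transfer D V best)"
    have mem: "set (u # us) = {w \<in> set N. compatible D V w}"
      using Cons by (metis set_filter)
    have len: "length us \<le> length N"
      using length_filter_le[of "compatible D V" N] Cons by simp
    have argmax: "ensures (argmax (transfer D V) u us) (4 * length N + 1)
      (\<lambda>z. z \<in> set (u # us) \<and> (\<forall>x\<in>set (u # us). transfer D V x \<le> transfer D V z))"
      by (rule ensures_mono[OF argmax_ensures]) (use len in auto)
    have "ensures (add_rides D (Suc i) Vs (?v best # N) ((best, ?v best, 0) # E)) b Q"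
      if best: "best \<in> set (u # us) \<and> (\<forall>x\<in>set (u # us). transfer D V x \<le> transfer D V best)"
      for best
    proof -
      have "complete_graph D (insert V R) (?v best # N)"
        by (rule complete_graph_insert[OF Cons.prems(2) origin]) (use best mem in auto)
      moreover have "sound_graph D (insert V R) (Suc i) (?v best # N) ((best, ?v best, 0) # E)"
        using sound_graph_extend[OF Cons.prems(1)] best origin mem by blast
      ultimately show ?thesis
        by (intro ensures_mono[OF Cons.IH[OF _ _ rest]]) (auto simp: Q_def b_def)
    qed
    then show ?thesis
      unfolding Cons list.case by (intro ensures_bind[OF argmax] ensures_compute_bind)
  qed
  have "ensures (add_rides D i (V # Vs) N E)
    (Suc ((2 * length N + 1) + ((4 * length N + 1) + Suc b))) Q"
    unfolding add_rides.simps(2)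
    by (intro ensures_step ensures_bind[OF compatible_nodes_ensures]) (use main in simp)
  then show ?case
    unfolding Q_def by (rule ensures_mono) (auto simp: b_def algebra_simps)
qed

section \<open>Optimality of the output and total cost\<close>

lemma sound_graph_source:
  "sound_graph D {} 1 [Node 0 source_ride (init_power D)] []"
  by (simp add: sound_graph_def)

lemma complete_graph_source:
  "complete_graph D {} [Node 0 source_ride (init_power D)]"
  by (simp add: complete_graph_def)

text \<open>Soundness makes the trace of \<open>y\<close> feasible with exactly the arrival time of
  \<open>y\<close>; completeness gives every competitor a node that arrives no later than it
  does.\<close>

lemma optimal_trace:
  assumes D: "valid_uav D" and R: "\<forall>V\<in>R. valid_ride D V"
    and sound: "sound_graph D R k N E" and complete: "complete_graph D R N"
    and y: "y \<in> set N" "\<forall>u\<in>set N. node_arrival D y \<le> node_arrival D u"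
  shows "optimal_offline D R (trace y E)"
proof -
  have charging: "charging D > 0"
    using D by (simp add: valid_uav_def)
  have U: "set (trace y E) \<subseteq> R" "feasible D (trace y E)"
    "last_ride (trace y E) = ride_of y" "end_power D (trace y E) = weight y"
    using sound y(1) by (auto simp: sound_graph_def)
  \<comment> \<open>A competitor is represented by a fictitious node, which need not lie in
    \<open>N\<close>, so that \<open>node_arrival_antimono\<close> can compare it with nodes of the
    graph.\<close>
  have arrival: "arrival_time D W = node_arrival D (Node 0 (last_ride W) (end_power D W))"
    if "set W \<subseteq> R" for W
    using that R by (intro arrival_time_eq_node_arrival[OF D]) (auto simp: valid_ride_def)
  have "arrival_time D (trace y E) = node_arrival D y"
    using U R by (intro arrival_time_eq_node_arrival[OF D]) (auto simp: valid_ride_def)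
  moreover have "node_arrival D y \<le> arrival_time D W" if W: "set W \<subseteq> R" "feasible D W" for W
  proof -
    obtain W' where W': "set W' \<subseteq> set W" "increasing W'" "feasible D W'"
      "last_ride W' = last_ride W" "end_power D W \<le> end_power D W'"
      using increasing_exists[OF D _ W(2)] W(1) R by blast
    moreover from this W(1) obtain u where
      u: "u \<in> set N" "ride_of u = last_ride W'" "end_power D W' \<le> weight u"
      using complete unfolding complete_graph_def by (meson order_trans)
    ultimately have "node_arrival D u \<le> arrival_time D W"
      unfolding arrival[OF W(1)] by (intro node_arrival_antimono[OF charging]) auto
    with y(2) u(1) show ?thesis
      by fastforce
  qed
  ultimately show ?thesis
    using U by (simp add: optimal_offline_def)
qed

text \<open>The quadratic term consists of 2 n^2 for sorting and 6 n^2 for building the graph. The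
  remaining phases are linear, as there are at most n + 1 nodes and 2 n + 1 edges.\<close>

lemma optimal_hitching_ensures:
  assumes D: "valid_uav D" and Vs: "\<forall>V\<in>set Vs. valid_ride D V"
  shows "ensures (optimal_hitching D Vs) (8 * (length Vs)\<^sup>2 + 32 * length Vs + 19)
    (optimal_offline D (set Vs))"
proof -
  let ?n = "length Vs"
  have finish: "ensures (bind_prog (add_goal_edges D (goal_node D k) N E) (\<lambda>E'.
      bind_prog (edges_into (goal_node D k) E') (\<lambda>F.
      case F of [] \<Rightarrow> return []
      | e # es \<Rightarrow> bind_prog (argmax (\<lambda>(_, _, x). - x) e es)
          (\<lambda>(y, _, _). trace_back y E' []))))
    ((2 * (?n + 1) + 1) + ((2 * (2 * ?n + 1) + 1) + ((4 * (2 * ?n + 1) + 1) + (3 * (2 * ?n + 1) + 1))))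
    (optimal_offline D (set Vs))"
    if sound: "sound_graph D (set Vs) k N E" and complete: "complete_graph D (set Vs) N"
      and len: "length N \<le> ?n + 1" "length E \<le> ?n" for k N E
  proof -
    define G where "G = map (\<lambda>u. (u, goal_node D k, node_arrival D u)) (rev N)"
    \<comment> \<open>All heads in \<open>E\<close> have an index below \<open>k\<close>, that of
      the goal node, so the search for edges into the goal returns exactly \<open>G\<close>.\<close>
    have "\<forall>(u, v, x)\<in>set E. idx v \<noteq> k"
      using sound by (fastforce simp: sound_graph_def)
    then have "filter (\<lambda>(u, v, x). idx v = idx (goal_node D k)) E = []"
      by (auto simp: filter_empty_conv goal_node_def)
    moreover have "filter (\<lambda>(u, v, x). idx v = idx (goal_node D k)) G = G"
      by (auto simp: filter_id_conv G_def)
    ultimately have F: "filter (\<lambda>(u, v, x). idx v = idx (goal_node D k)) (G @ E) = G"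
      by simp
    \<comment> \<open>The empty sequence is feasible, so completeness yields a node. Hence the
      branch without edges into the goal is never taken.\<close>
    have "N \<noteq> []"
      using complete by (auto simp: complete_graph_def dest: spec[of _ "[]"])
    then obtain e es where G: "G = e # es"
      by (cases G) (auto simp: G_def)
    have lenG: "length G \<le> ?n + 1"
      using len(1) by (simp add: G_def)
    have trace: "trace y (G @ E) = trace y E" if "y \<in> set N" for y
      using sound that
      by (intro trace_append_other) (auto simp: G_def goal_node_def sound_graph_def)
    have step1: "ensures (add_goal_edges D (goal_node D k) N E) (2 * (?n + 1) + 1) (\<lambda>E'. E' = G @ E)"
      by (rule ensures_mono[OF add_goal_edges_ensures]) (use len in \<open>auto simp: G_def\<close>)
    have step2: "ensures (edges_into (goal_node D k) (G @ E)) (2 * (2 * ?n + 1) + 1) (\<lambda>F. F = G)"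
      by (rule ensures_mono[OF edges_into_ensures]) (use len lenG F in auto)
    \<comment> \<open>Maximizing the negated edge weight minimizes the arrival time.\<close>
    have step3: "ensures (argmax (\<lambda>(_, _, x). - x) e es) (4 * (2 * ?n + 1) + 1)
      (\<lambda>z. \<exists>y\<in>set N. z = (y, goal_node D k, node_arrival D y) \<and>
         (\<forall>u\<in>set N. node_arrival D y \<le> node_arrival D u))"
      by (rule ensures_mono[OF argmax_ensures], unfold G[symmetric])
        (use lenG G in \<open>auto simp: G_def\<close>)
    have step4: "ensures (trace_back y (G @ E) []) (3 * (2 * ?n + 1) + 1) (optimal_offline D (set Vs))"
      if "y \<in> set N" "\<forall>u\<in>set N. node_arrival D y \<le> node_arrival D u" for y
      by (rule ensures_mono[OF trace_back_ensures])
        (use len lenG that trace optimal_trace[OF D Vs sound complete] in auto)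
    show ?thesis
    proof (intro ensures_bind[OF step1], hypsubst, intro ensures_bind[OF step2], hypsubst,
        unfold G list.case, intro ensures_bind[OF step3])
      fix z
      assume "\<exists>y\<in>set N. z = (y, goal_node D k, node_arrival D y) \<and>
         (\<forall>u\<in>set N. node_arrival D y \<le> node_arrival D u)"
      then show "ensures (case z of (y, _, _) \<Rightarrow> trace_back y ((e # es) @ E) [])
        (3 * (2 * ?n + 1) + 1) (optimal_offline D (set Vs))"
        using step4 unfolding G by auto
    qed
  qed
  have "ensures (optimal_hitching D Vs)
    (Suc ((?n * (2 * ?n + 2) + 1) + ((?n * (6 * (1 + ?n) + 4) + 1) +
      ((2 * (?n + 1) + 1) + ((2 * (2 * ?n + 1) + 1) + ((4 * (2 * ?n + 1) + 1) + (3 * (2 * ?n + 1) + 1)))))))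
    (optimal_offline D (set Vs))"
    unfolding optimal_hitching_def Let_def
  proof (intro ensures_step ensures_bind[OF sort_rides_ensures])
    fix Ws
    assume Ws: "set Ws = set Vs \<and> length Ws = ?n \<and>
      sorted_wrt (\<lambda>V W. origin V \<le> origin W) Ws"
    have graph: "ensures (add_rides D 1 Ws [Node 0 source_ride (init_power D)] [])
      (?n * (6 * (1 + ?n) + 4) + 1)
      (\<lambda>(k, N, E). sound_graph D (set Vs) k N E \<and> complete_graph D (set Vs) N \<and>
        length N \<le> ?n + 1 \<and> length E \<le> ?n)"
      by (rule ensures_mono[OF add_rides_ensures[OF sound_graph_source complete_graph_source]])
        (use Ws Vs in \<open>auto simp: valid_ride_def\<close>)
    show "ensures (bind_prog (add_rides D 1 Ws [Node 0 source_ride (init_power D)] [])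
      (\<lambda>(k, N, E). bind_prog (add_goal_edges D (goal_node D k) N E) (\<lambda>E'.
        bind_prog (edges_into (goal_node D k) E') (\<lambda>F.
        case F of [] \<Rightarrow> return []
        | e # es \<Rightarrow> bind_prog (argmax (\<lambda>(_, _, x). - x) e es)
            (\<lambda>(y, _, _). trace_back y E' [])))))
      ((?n * (6 * (1 + ?n) + 4) + 1) + ((2 * (?n + 1) + 1) + ((2 * (2 * ?n + 1) + 1) +
        ((4 * (2 * ?n + 1) + 1) + (3 * (2 * ?n + 1) + 1)))))
      (optimal_offline D (set Vs))"
      by (rule ensures_bind[OF graph]) (use finish in auto)
  qed
  then show ?thesis
    by (rule ensures_mono) (auto simp: power2_eq_square algebra_simps)
qed

theorem theorem2:
  "\<exists>T :: nat \<Rightarrow> nat.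
     (\<lambda>n. real (T n)) \<in> O(\<lambda>n. (real n)\<^sup>2) \<and>
     (\<forall>(D :: uav) (Vs :: ride list).
        valid_uav D \<and> (\<forall>V\<in>set Vs. valid_ride D V) \<longrightarrow>
          runs (optimal_hitching D Vs) \<noteq> {} \<and>
          (\<forall>(U, c)\<in>runs (optimal_hitching D Vs).
             c \<le> T (length Vs) \<and> optimal_offline D (set Vs) U))"
proof (intro exI conjI)
  \<comment> \<open>This goal instantiates the schematic \<open>T\<close> by the polynomial of
    \<open>optimal_hitching_ensures\<close>.\<close>
  show "(\<lambda>n. real (8 * n\<^sup>2 + 32 * n + 19)) \<in> O(\<lambda>n. (real n)\<^sup>2)"
    unfolding of_nat_add of_nat_mult of_nat_power by real_asymp
  show "\<forall>(D :: uav) (Vs :: ride list).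
        valid_uav D \<and> (\<forall>V\<in>set Vs. valid_ride D V) \<longrightarrow>
          runs (optimal_hitching D Vs) \<noteq> {} \<and>
          (\<forall>(U, c)\<in>runs (optimal_hitching D Vs).
             c \<le> 8 * (length Vs)\<^sup>2 + 32 * length Vs + 19 \<and> optimal_offline D (set Vs) U)"
    using optimal_hitching_ensures unfolding ensures_def by blast
qed

end
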